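(* Let $\varphi$ be a sentence of $\mathrm{BndSCL}$ and suppose $\mathfrak{A}\models_\omega\varphi$. Then there exists a countable substructure $\mathfrak{B}$ of $\mathfrak{A}$ such that $\mathfrak{B}\models_\omega\varphi$.
   Context: Syntax. Fix purely relational vocabularies. $\mathrm{FO}$ has equality and $\bot$ as primitives and $\neg,\wedge,\vee,\exists,\forall$. Fix label symbols $L_0,L_1,\dots$ and for each $L$ a claim symbol $C_L$. Formulas: $\mathrm{FO}$ formation rules plus: each $C_L$ is atomic (no free variables); if $\varphi$ is a formula, $L\varphi$ is a formula (same free variables). A sentence has no free variables. FO-atoms are the atomic formulas of $\mathrm{FO}$. The reference formula of an occurrence of $C_L$ is the subformula occurrence $L\psi$ above it in the syntax tree with no occurrence of $L$ strictly between (if any). Bounded semantics ($\mathrm{BndSCL}$). $\mathcal{G}_n(\mathfrak{A},s,\varphi)$ has positions $(\psi,r,\#,m)$, $\#\in\{+,-\}$, clock $m\in\mathbb{N}$, starting at $(\varphi,s,+,n)$. FO-atom $\alpha$: if $\#=+$ Eloise wins iff $\mathfrak{A},r\models\alpha$, else Abelard; if $\#=-$ Abelard wins iff $\mathfrak{A},r\models\alpha$, else Eloise. $\neg$ flips the sign. $\wedge$: Abelard chooses if $+$, Eloise if $-$. $\vee$: Eloise if $+$, Abelard if $-$. $\forall x$: Abelard picks $a\in A$ if $+$, Eloise if $-$, assignment becomes $r[a/x]$. $\exists x$: Eloise if $+$, Abelard if $-$. $L\psi$: move to $\psi$. $C_L$: if $m>0$ move to its reference formula with clock $m-1$; if $m=0$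 or there is no reference formula the play ends with no winner. $\mathcal{G}_\omega(\mathfrak{A},s,\varphi)$: Abelard picks $n'$, Eloise picks $n\ge n'$, then $\mathcal{G}_n$ is played. $\mathfrak{A}\models_\omega\varphi$ (for a sentence, with the empty assignment) iff Eloise has a winning strategy in $\mathcal{G}_\omega(\mathfrak{A},\varnothing,\varphi)$. *)

theory Defs
  imports Main "HOL-Library.Sublist" "HOL-Library.Countable_Set"
begin

text \<open>A relational vocabulary is a partial map: the symbols are its domain, the values are
  the arities.\<close>

type_synonym 'r vocab = "'r \<rightharpoonup> nat"

record ('r, 'a) struct =
  univ :: "'a set"
  interp :: "'r \<Rightarrow> 'a list set"

definition is_structure :: "'r vocab \<Rightarrow> ('r, 'a) struct \<Rightarrow> bool" where
  "is_structure \<tau> \<AA> \<longleftrightarrow> univ \<AA> \<noteq> {} \<and>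
     (\<forall>R k. \<tau> R = Some k \<longrightarrow> interp \<AA> R \<subseteq> {as \<in> lists (univ \<AA>). length as = k})"

text \<open>The interpretation of symbols outside the vocabulary is irrelevant and left unconstrained.\<close>

definition substructure :: "'r vocab \<Rightarrow> ('r, 'a) struct \<Rightarrow> ('r, 'a) struct \<Rightarrow> bool" where
  "substructure \<tau> \<BB> \<AA> \<longleftrightarrow> is_structure \<tau> \<BB> \<and> univ \<BB> \<subseteq> univ \<AA> \<and>
     (\<forall>R \<in> dom \<tau>. interp \<BB> R = interp \<AA> R \<inter> lists (univ \<BB>))"


type_synonym var = nat
type_synonym label = nat

datatype 'r atom = Bot | Eq var var | Rel 'r "var list"

datatype 'r fm =
    Atom "'r atom"
  | Claim label
  | Neg "'r fm"
  | And "'r fm" "'r fm"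
  | Or "'r fm" "'r fm"
  | Ex var "'r fm"
  | All var "'r fm"
  | Label label "'r fm"

primrec atom_vars :: "'r atom \<Rightarrow> var set" where
  "atom_vars Bot = {}"
| "atom_vars (Eq x y) = {x, y}"
| "atom_vars (Rel R xs) = set xs"

primrec free_vars :: "'r fm \<Rightarrow> var set" where
  "free_vars (Atom \<alpha>) = atom_vars \<alpha>"
| "free_vars (Claim l) = {}"
| "free_vars (Neg \<phi>) = free_vars \<phi>"
| "free_vars (And \<phi> \<psi>) = free_vars \<phi> \<union> free_vars \<psi>"
| "free_vars (Or \<phi> \<psi>) = free_vars \<phi> \<union> free_vars \<psi>"
| "free_vars (Ex x \<phi>) = free_vars \<phi> - {x}"
| "free_vars (All x \<phi>) = free_vars \<phi> - {x}"
| "free_vars (Label l \<phi>) = free_vars \<phi>"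

primrec atom_over :: "'r vocab \<Rightarrow> 'r atom \<Rightarrow> bool" where
  "atom_over \<tau> Bot \<longleftrightarrow> True"
| "atom_over \<tau> (Eq x y) \<longleftrightarrow> True"
| "atom_over \<tau> (Rel R xs) \<longleftrightarrow> \<tau> R = Some (length xs)"

primrec fm_over :: "'r vocab \<Rightarrow> 'r fm \<Rightarrow> bool" where
  "fm_over \<tau> (Atom \<alpha>) \<longleftrightarrow> atom_over \<tau> \<alpha>"
| "fm_over \<tau> (Claim l) \<longleftrightarrow> True"
| "fm_over \<tau> (Neg \<phi>) \<longleftrightarrow> fm_over \<tau> \<phi>"
| "fm_over \<tau> (And \<phi> \<psi>) \<longleftrightarrow> fm_over \<tau> \<phi> \<and> fm_over \<tau> \<psi>"
| "fm_over \<tau> (Or \<phi> \<psi>) \<longleftrightarrow> fm_over \<tau> \<phi> \<and> fm_over \<tau> \<psi>"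
| "fm_over \<tau> (Ex x \<phi>) \<longleftrightarrow> fm_over \<tau> \<phi>"
| "fm_over \<tau> (All x \<phi>) \<longleftrightarrow> fm_over \<tau> \<phi>"
| "fm_over \<tau> (Label l \<phi>) \<longleftrightarrow> fm_over \<tau> \<phi>"

definition sentence :: "'r vocab \<Rightarrow> 'r fm \<Rightarrow> bool" where
  "sentence \<tau> \<phi> \<longleftrightarrow> fm_over \<tau> \<phi> \<and> free_vars \<phi> = {}"


text \<open>A subformula occurrence of a formula is given by its address, the list of child indices
  leading to it from the root of the syntax tree.\<close>

type_synonym addr = "nat list"

primrec children :: "'r fm \<Rightarrow> 'r fm list" where
  "children (Atom \<alpha>) = []"
| "children (Claim l) = []"
| "children (Neg \<phi>) = [\<phi>]"
| "children (And \<phi> \<psi>) = [\<phi>, \<psi>]"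
| "children (Or \<phi> \<psi>) = [\<phi>, \<psi>]"
| "children (Ex x \<phi>) = [\<phi>]"
| "children (All x \<phi>) = [\<phi>]"
| "children (Label l \<phi>) = [\<phi>]"

fun fm_at :: "'r fm \<Rightarrow> addr \<Rightarrow> 'r fm option" where
  "fm_at \<phi> [] = Some \<phi>"
| "fm_at \<phi> (i # p) = (if i < length (children \<phi>) then fm_at (children \<phi> ! i) p else None)"

definition labelled_at :: "'r fm \<Rightarrow> label \<Rightarrow> addr \<Rightarrow> bool" where
  "labelled_at \<phi> l q \<longleftrightarrow> (\<exists>\<psi>. fm_at \<phi> q = Some (Label l \<psi>))"

text \<open>\<open>q\<close> is the address of the reference formula of the occurrence of \<open>Claim l\<close> at \<open>p\<close>.\<close>

definition reference :: "'r fm \<Rightarrow> label \<Rightarrow> addr \<Rightarrow> addr \<Rightarrow> bool" where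
  "reference \<phi> l p q \<longleftrightarrow> strict_prefix q p \<and> labelled_at \<phi> l q \<and>
     \<not> (\<exists>q'. strict_prefix q q' \<and> strict_prefix q' p \<and> labelled_at \<phi> l q')"


datatype player = Eloise | Abelard

text \<open>\<open>turn p = None\<close> means that no player chooses at \<open>p\<close>: the play ends there or the move is
  forced. A play ends at the positions without moves; \<open>winner\<close> matters only at those, and
  \<open>winner p = None\<close> means that a play ending at \<open>p\<close> is won by neither player.\<close>

record 'p game =
  start :: 'p
  turn :: "'p \<Rightarrow> player option"
  moves :: "'p \<Rightarrow> 'p set"
  winner :: "'p \<Rightarrow> player option"

text \<open>Nonempty finite initial segments of plays in which Eloise follows the strategy \<open>\<sigma>\<close>, a
  function of the history. Eloise is stuck if \<open>\<sigma>\<close> prescribes an illegal move; winning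
  strategies exclude this.\<close>

inductive follows :: "'p game \<Rightarrow> ('p list \<Rightarrow> 'p) \<Rightarrow> 'p list \<Rightarrow> bool"
  for G :: "'p game" and \<sigma> :: "'p list \<Rightarrow> 'p" where
  start: "follows G \<sigma> [start G]"
| Eloise: "\<lbrakk>follows G \<sigma> h; turn G (last h) = Some Eloise; \<sigma> h \<in> moves G (last h)\<rbrakk>
    \<Longrightarrow> follows G \<sigma> (h @ [\<sigma> h])"
| other: "\<lbrakk>follows G \<sigma> h; turn G (last h) \<noteq> Some Eloise; p \<in> moves G (last h)\<rbrakk>
    \<Longrightarrow> follows G \<sigma> (h @ [p])"

text \<open>The last conjunct says that infinite plays are not won by Eloise. The games below have no
  infinite plays.\<close>

definition winning_strategy :: "'p game \<Rightarrow> ('p list \<Rightarrow> 'p) \<Rightarrow> bool" where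
  "winning_strategy G \<sigma> \<longleftrightarrow>
     (\<forall>h. follows G \<sigma> h \<longrightarrow>
        (if moves G (last h) = {} then winner G (last h) = Some Eloise
         else turn G (last h) = Some Eloise \<longrightarrow> \<sigma> h \<in> moves G (last h))) \<and>
     \<not> (\<exists>\<rho> :: nat \<Rightarrow> 'p. \<forall>k. follows G \<sigma> (map \<rho> [0..<Suc k]))"


datatype sign = Plus | Minus

primrec flip :: "sign \<Rightarrow> sign" where
  "flip Plus = Minus"
| "flip Minus = Plus"

text \<open>Assignments are partial, so that there is an empty one. The \<open>the\<close> below is harmless: in the
  games for a sentence, started with the empty assignment, every variable of an FO-atom has a
  value when that atom is reached.\<close>

type_synonym 'a assignment = "var \<rightharpoonup> 'a"

primrec sat_atom :: "('r, 'a) struct \<Rightarrow> 'a assignment \<Rightarrow> 'r atom \<Rightarrow> bool" where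
  "sat_atom \<AA> r Bot \<longleftrightarrow> False"
| "sat_atom \<AA> r (Eq x y) \<longleftrightarrow> the (r x) = the (r y)"
| "sat_atom \<AA> r (Rel R xs) \<longleftrightarrow> map (\<lambda>x. the (r x)) xs \<in> interp \<AA> R"

text \<open>A position: the subformula occurrence, the assignment, the sign and the clock.\<close>

type_synonym 'a pos = "addr \<times> 'a assignment \<times> sign \<times> nat"

fun bnd_turn :: "'r fm \<Rightarrow> 'a pos \<Rightarrow> player option" where
  "bnd_turn \<phi> (p, r, s, m) = (case fm_at \<phi> p of
     Some (And _ _) \<Rightarrow> Some (if s = Plus then Abelard else Eloise)
   | Some (Or _ _) \<Rightarrow> Some (if s = Plus then Eloise else Abelard)
   | Some (All _ _) \<Rightarrow> Some (if s = Plus then Abelard else Eloise)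
   | Some (Ex _ _) \<Rightarrow> Some (if s = Plus then Eloise else Abelard)
   | _ \<Rightarrow> None)"

fun bnd_moves :: "('r, 'a) struct \<Rightarrow> 'r fm \<Rightarrow> 'a pos \<Rightarrow> 'a pos set" where
  "bnd_moves \<AA> \<phi> (p, r, s, m) = (case fm_at \<phi> p of
     Some (Neg _) \<Rightarrow> {(p @ [0], r, flip s, m)}
   | Some (And _ _) \<Rightarrow> {(p @ [0], r, s, m), (p @ [1], r, s, m)}
   | Some (Or _ _) \<Rightarrow> {(p @ [0], r, s, m), (p @ [1], r, s, m)}
   | Some (All x _) \<Rightarrow> {(p @ [0], r(x \<mapsto> a), s, m) | a. a \<in> univ \<AA>}
   | Some (Ex x _) \<Rightarrow> {(p @ [0], r(x \<mapsto> a), s, m) | a. a \<in> univ \<AA>}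
   | Some (Label _ _) \<Rightarrow> {(p @ [0], r, s, m)}
   | Some (Claim l) \<Rightarrow> {(q, r, s, m - 1) | q. m > 0 \<and> reference \<phi> l p q}
   | _ \<Rightarrow> {})"

fun bnd_winner :: "('r, 'a) struct \<Rightarrow> 'r fm \<Rightarrow> 'a pos \<Rightarrow> player option" where
  "bnd_winner \<AA> \<phi> (p, r, s, m) = (case fm_at \<phi> p of
     Some (Atom \<alpha>) \<Rightarrow>
       Some (if s = Plus then (if sat_atom \<AA> r \<alpha> then Eloise else Abelard)
             else (if sat_atom \<AA> r \<alpha> then Abelard else Eloise))
   | _ \<Rightarrow> None)"

definition bnd_game :: "nat \<Rightarrow> ('r, 'a) struct \<Rightarrow> 'a assignment \<Rightarrow> 'r fm \<Rightarrow> 'a pos game" where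
  "bnd_game n \<AA> r \<phi> =
     \<lparr>start = ([], r, Plus, n), turn = bnd_turn \<phi>, moves = bnd_moves \<AA> \<phi>,
      winner = bnd_winner \<AA> \<phi>\<rparr>"

text \<open>\<open>Raise n'\<close> is the position after Abelard has picked \<open>n'\<close>; \<open>In n p\<close> is the position \<open>p\<close> of
  the game with initial clock \<open>n\<close>.\<close>

datatype 'p omega_pos = Init | Raise nat | In nat 'p

definition omega_game :: "('r, 'a) struct \<Rightarrow> 'a assignment \<Rightarrow> 'r fm \<Rightarrow> 'a pos omega_pos game" where
  "omega_game \<AA> r \<phi> =
     \<lparr>start = Init,
      turn = (\<lambda>u. case u of
          Init \<Rightarrow> Some Abelard
        | Raise n' \<Rightarrow> Some Eloise
        | In n p \<Rightarrow> turn (bnd_game n \<AA> r \<phi>) p),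
      moves = (\<lambda>u. case u of
          Init \<Rightarrow> range Raise
        | Raise n' \<Rightarrow> {In n (start (bnd_game n \<AA> r \<phi>)) | n. n \<ge> n'}
        | In n p \<Rightarrow> In n ` moves (bnd_game n \<AA> r \<phi>) p),
      winner = (\<lambda>u. case u of
          Init \<Rightarrow> None
        | Raise n' \<Rightarrow> None
        | In n p \<Rightarrow> winner (bnd_game n \<AA> r \<phi>) p)\<rparr>"

definition models_omega :: "('r, 'a) struct \<Rightarrow> 'r fm \<Rightarrow> bool"
    ("(_ \<Turnstile>\<^sub>\<omega> _)" [51, 51] 50) where
  "\<AA> \<Turnstile>\<^sub>\<omega> \<phi> \<longleftrightarrow> (\<exists>\<sigma>. winning_strategy (omega_game \<AA> Map.empty \<phi>) \<sigma>)"

end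

theory Submission
  imports Defs
begin

text \<open>A winning strategy for Eloise yields the set of positions it can reach, and conversely, in a
  game without infinite plays, a set of positions containing the start that Eloise can avoid leaving
  and in which every final position is hers yields a winning strategy. It therefore suffices to
  find a countable \<open>B \<subseteq> A\<close> that is closed, in the style of Tarski and Vaught, under witnesses for
  Eloise's quantifier moves within such a set for \<open>\<AA>\<close>; the positions of that set with
  finite assignments into \<open>B\<close> then work for the substructure on \<open>B\<close>.\<close>

section \<open>Winning strategies as sets of positions\<close>

text \<open>The last clause covers forced moves as well as Abelard's choices, matching the rule
  \<open>other\<close> of \<open>follows\<close>.\<close>

definition safe_set :: "'p game \<Rightarrow> 'p set \<Rightarrow> bool" where
  "safe_set G Z \<longleftrightarrow> (\<forall>p \<in> Z.
     (moves G p = {} \<longrightarrow> winner G p = Some Eloise) \<and>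
     (moves G p \<noteq> {} \<longrightarrow> turn G p = Some Eloise \<longrightarrow> moves G p \<inter> Z \<noteq> {}) \<and>
     (turn G p \<noteq> Some Eloise \<longrightarrow> moves G p \<subseteq> Z))"

lemma follows_nonempty: "follows G \<sigma> h \<Longrightarrow> h \<noteq> []"
  by (induction rule: follows.induct) auto

lemma follows_snoc_move:
  assumes "follows G \<sigma> (h @ [p])" and "h \<noteq> []"
  shows "p \<in> moves G (last h)"
  using assms by (cases rule: follows.cases) auto

text \<open>Each position of the set ends some history following \<open>\<sigma>\<close>; prolonging
  that history by \<open>\<sigma> h\<close>, or by any move that is not Eloise's, supplies the
  required successors.\<close>

lemma winning_strategy_safe_set:
  assumes "winning_strategy G \<sigma>"
  shows "safe_set G (last ` Collect (follows G \<sigma>))"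
proof -
  have "(moves G (last h) = {} \<longrightarrow> winner G (last h) = Some Eloise) \<and>
     (moves G (last h) \<noteq> {} \<longrightarrow> turn G (last h) = Some Eloise \<longrightarrow>
        moves G (last h) \<inter> last ` Collect (follows G \<sigma>) \<noteq> {}) \<and>
     (turn G (last h) \<noteq> Some Eloise \<longrightarrow> moves G (last h) \<subseteq> last ` Collect (follows G \<sigma>))"
    if h: "follows G \<sigma> h" for h
  proof (intro conjI impI subsetI)
    assume "moves G (last h) = {}"
    then show "winner G (last h) = Some Eloise"
      using assms h by (auto simp: winning_strategy_def)
  next
    assume "moves G (last h) \<noteq> {}" and t: "turn G (last h) = Some Eloise"
    then have s: "\<sigma> h \<in> moves G (last h)"
      using assms h by (auto simp: winning_strategy_def)
    have "last (h @ [\<sigma> h]) \<in> last ` Collect (follows G \<sigma>)"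
      using follows.Eloise[OF h t s] by blast
    then show "moves G (last h) \<inter> last ` Collect (follows G \<sigma>) \<noteq> {}"
      using s by auto
  next
    fix p assume "turn G (last h) \<noteq> Some Eloise" and "p \<in> moves G (last h)"
    then have "last (h @ [p]) \<in> last ` Collect (follows G \<sigma>)"
      using follows.other[OF h] by blast
    then show "p \<in> last ` Collect (follows G \<sigma>)" by simp
  qed
  then show ?thesis by (auto simp: safe_set_def)
qed

text \<open>A positional strategy suffices: always choosing a move into \<open>Z\<close> keeps every
  play inside \<open>Z\<close>, and well-foundedness rules out infinite plays.\<close>

lemma safe_set_winning_strategy:
  assumes wf: "wf {(q, p). q \<in> moves G p}" and safe: "safe_set G Z" and start: "start G \<in> Z"
  shows "\<exists>\<sigma>. winning_strategy G \<sigma>"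
proof -
  define \<sigma> where "\<sigma> h = (SOME q. q \<in> moves G (last h) \<inter> Z)" for h
  have \<sigma>: "\<sigma> h \<in> moves G (last h) \<inter> Z"
    if "last h \<in> Z" "turn G (last h) = Some Eloise" "moves G (last h) \<noteq> {}" for h
  proof -
    have "\<exists>q. q \<in> moves G (last h) \<inter> Z"
      using that safe unfolding safe_set_def by blast
    then show ?thesis unfolding \<sigma>_def by (rule someI_ex)
  qed
  have Z: "last h \<in> Z" if "follows G \<sigma> h" for h
    using that
  proof (induction rule: follows.induct)
    case start
    then show ?case using assms(3) by simp
  next
    case (Eloise h)
    then show ?case using \<sigma> by auto
  next
    case (other h p)
    then show ?case using safe by (auto simp: safe_set_def)
  qed
  have "\<not> (\<forall>k. follows G \<sigma> (map \<rho> [0..<Suc k]))" for \<rho>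
  proof
    assume \<rho>: "\<forall>k. follows G \<sigma> (map \<rho> [0..<Suc k])"
    \<comment> \<open>An infinite play is an infinite descending chain of the move relation.\<close>
    have "\<rho> (Suc k) \<in> moves G (\<rho> k)" for k
      using follows_snoc_move[of G \<sigma> "map \<rho> [0..<Suc k]" "\<rho> (Suc k)"] \<rho>[rule_format, of "Suc k"]
      by simp
    then show False using wf by (auto simp: wf_iff_no_infinite_down_chain)
  qed
  moreover have "if moves G (last h) = {} then winner G (last h) = Some Eloise
      else turn G (last h) = Some Eloise \<longrightarrow> \<sigma> h \<in> moves G (last h)" if "follows G \<sigma> h" for h
    using Z[OF that] \<sigma>[of h] safe unfolding safe_set_def by simp
  ultimately have "winning_strategy G \<sigma>"
    unfolding winning_strategy_def by blast
  then show ?thesis by blast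
qed

section \<open>Termination of the games\<close>

lemma fm_at_append:
  "fm_at \<phi> (p @ q) = (case fm_at \<phi> p of None \<Rightarrow> None | Some \<psi> \<Rightarrow> fm_at \<psi> q)"
  by (induction \<phi> p rule: fm_at.induct) auto

lemma fm_over_fm_at: "fm_over \<tau> \<phi> \<Longrightarrow> fm_at \<phi> p = Some \<psi> \<Longrightarrow> fm_over \<tau> \<psi>"
proof (induction \<phi> p rule: fm_at.induct)
  case (2 \<phi> i p)
  then have "i < length (children \<phi>)" and at: "fm_at (children \<phi> ! i) p = Some \<psi>"
    by (auto split: if_splits)
  moreover from this have "fm_over \<tau> (children \<phi> ! i)"
    using 2(2) by (cases \<phi>) (auto simp: less_Suc_eq nth_Cons')
  ultimately show ?case using 2(1) by blast
qed simp

text \<open>The components are the phase of the play, the clock and the size of the current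
  subformula. The phase leads because the clock picked at \<open>Raise\<close> is unbounded.\<close>

fun omega_rank :: "'r fm \<Rightarrow> 'a pos omega_pos \<Rightarrow> nat \<times> nat \<times> nat" where
  "omega_rank \<phi> Init = (2, 0, 0)"
| "omega_rank \<phi> (Raise n) = (1, 0, 0)"
| "omega_rank \<phi> (In n (p, r, s, m)) =
     (0, m, case fm_at \<phi> p of None \<Rightarrow> 0 | Some \<psi> \<Rightarrow> size \<psi>)"

text \<open>A claim jumps up to a larger formula but lowers the clock, since it requires
  \<open>m > 0\<close>; every other move keeps the clock and enters an immediate subformula.\<close>

lemma bnd_moves_decrease:
  assumes "(q, r', s', m') \<in> bnd_moves \<AA> \<phi> (p, r, s, m)"
  shows "(omega_rank \<phi> (In n (q, r', s', m')), omega_rank \<phi> (In n (p, r, s, m)))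
    \<in> less_than <*lex*> less_than <*lex*> less_than"
proof (cases "fm_at \<phi> p")
  case None
  then show ?thesis using assms by simp
next
  case (Some \<psi>)
  then show ?thesis using assms by (cases \<psi>) (auto simp: fm_at_append)
qed

lemma wf_omega_game: "wf {(v, u). v \<in> moves (omega_game \<AA> r \<phi>) u}"
proof (rule wf_subset)
  show "wf (inv_image (less_than <*lex*> less_than <*lex*> less_than) (omega_rank \<phi>))"
    by (intro wf_inv_image wf_lex_prod wf_less_than)
  show "{(v, u). v \<in> moves (omega_game \<AA> r \<phi>) u}
    \<subseteq> inv_image (less_than <*lex*> less_than <*lex*> less_than) (omega_rank \<phi>)"
  proof clarify
    fix v u assume v: "v \<in> moves (omega_game \<AA> r \<phi>) u"
    show "(v, u) \<in> inv_image (less_than <*lex*> less_than <*lex*> less_than) (omega_rank \<phi>)"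
    proof (cases u)
      case (In n x)
      obtain p t s m where x: "x = (p, t, s, m)" by (cases x)
      obtain q t' s' m' where "v = In n (q, t', s', m')"
          "(q, t', s', m') \<in> bnd_moves \<AA> \<phi> (p, t, s, m)"
        using v unfolding In x by (auto simp: omega_game_def bnd_game_def)
      then show ?thesis using bnd_moves_decrease[of q t' s' m'] unfolding In x inv_image_def by blast
    qed (use v in \<open>auto simp: omega_game_def bnd_game_def\<close>)
  qed
qed

section \<open>Countable closure under witnesses\<close>

text \<open>A finite map is \<open>map_of\<close> of a list of pairs, and lists over a countable set
  are countable. Total maps from \<open>nat\<close> into two points would already be too
  many.\<close>

lemma countable_finite_maps:
  assumes "countable B"
  shows "countable {r :: 'k :: countable \<rightharpoonup> 'b. finite (dom r) \<and> ran r \<subseteq> B}"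
proof (rule countable_subset)
  show "countable (map_of ` lists ((UNIV :: 'k set) \<times> B))"
    using assms by (intro countable_image countable_lists countable_SIGMA) auto
  show "{r :: 'k \<rightharpoonup> 'b. finite (dom r) \<and> ran r \<subseteq> B} \<subseteq> map_of ` lists (UNIV \<times> B)"
  proof clarify
    fix r :: "'k \<rightharpoonup> 'b" assume r: "finite (dom r)" "ran r \<subseteq> B"
    obtain ks where ks: "set ks = dom r" using finite_list[OF r(1)] by blast
    have "r = map_of (map (\<lambda>k. (k, the (r k))) ks)"
      using ks by (auto simp: map_of_map_restrict fun_eq_iff restrict_map_def dom_def)
    moreover have "map (\<lambda>k. (k, the (r k))) ks \<in> lists (UNIV \<times> B)"
      using ks r(2) by (force simp: ran_def)
    ultimately show "r \<in> map_of ` lists (UNIV \<times> B)" by blast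
  qed
qed

text \<open>The closure step of the downward Loewenheim-Skolem theorem: one chosen witness is added
  for each index and each finite map, and this is repeated through all finite stages.\<close>

lemma countable_witness_closure:
  fixes P :: "'i :: countable \<Rightarrow> ('k :: countable \<rightharpoonup> 'b) \<Rightarrow> 'b \<Rightarrow> bool"
  assumes C: "countable C" "C \<subseteq> U"
  obtains B where "countable B" "C \<subseteq> B" "B \<subseteq> U"
    "\<And>i r. finite (dom r) \<Longrightarrow> ran r \<subseteq> B \<Longrightarrow> \<exists>a\<in>U. P i r a \<Longrightarrow> \<exists>a\<in>B. P i r a"
proof -
  define M where "M X = {r :: 'k \<rightharpoonup> 'b. finite (dom r) \<and> ran r \<subseteq> X}" for X
  define w where "w i r = (SOME a. a \<in> U \<and> P i r a)" for i r
  \<comment> \<open>Intersecting with \<open>U\<close> discards the arbitrary values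
    \<open>w i r\<close> takes where no witness exists.\<close>
  define S where "S X = X \<union> ((\<lambda>(i, r). w i r) ` (UNIV \<times> M X) \<inter> U)" for X
  define F where "F k = (S ^^ k) C" for k
  have F: "F 0 = C" "F (Suc k) = S (F k)" for k by (auto simp: F_def)
  have mono: "mono F" by (rule mono_iff_le_Suc[THEN iffD2]) (auto simp: F S_def)
  show ?thesis
  proof (rule that[of "\<Union>k. F k"])
    have "countable (F k)" for k
    proof (induction k)
      case (Suc k)
      have "countable (UNIV \<times> M (F k) :: ('i \<times> _) set)"
        using countable_finite_maps[OF Suc] unfolding M_def by (intro countable_SIGMA) auto
      then show ?case using Suc by (auto simp: F S_def)
    qed (use C in \<open>simp add: F\<close>)
    then show "countable (\<Union>k. F k)" by simp
    show "C \<subseteq> (\<Union>k. F k)" using F(1) by blast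
    have "F k \<subseteq> U" for k using C by (induction k) (auto simp: F S_def)
    then show "(\<Union>k. F k) \<subseteq> U" by blast
  next
    fix i r assume r: "finite (dom r)" "ran r \<subseteq> (\<Union>k. F k)" and ex: "\<exists>a\<in>U. P i r a"
    \<comment> \<open>Being finite, \<open>ran r\<close> lies inside a single stage of the
      increasing chain, so its witness appears at the next one.\<close>
    have "finite (ran r)" using r(1) by (rule finite_ran)
    then have "\<exists>k. ran r \<subseteq> F k"
      using r(2)
    proof (induction rule: finite_subset_induct')
      case (insert x X)
      then obtain k l where "x \<in> F k" "X \<subseteq> F l" by blast
      then have "insert x X \<subseteq> F (max k l)"
        using monoD[OF mono, of k "max k l"] monoD[OF mono, of l "max k l"] by auto
      then show ?case by blast
    qed simp
    then obtain k where k: "ran r \<subseteq> F k" by blast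
    have "w i r \<in> U \<and> P i r (w i r)" unfolding w_def by (rule someI_ex) (use ex in blast)
    moreover from this have "w i r \<in> F (Suc k)" using k r(1) by (force simp: F S_def M_def)
    ultimately show "\<exists>a\<in>\<Union>k. F k. P i r a" by blast
  qed
qed

section \<open>Passing to a substructure\<close>

text \<open>Lets the tuples \<open>(n, p, x, s, m)\<close>, which contain a sign, index the witness
  closure.\<close>

instance sign :: countable
  by countable_datatype

text \<open>An unassigned variable is read as the unspecified element \<open>the None\<close>. Putting that element
  into \<open>\<BB>\<close> whenever it lies in \<open>\<AA>\<close> makes it unnecessary to track which variables are assigned.\<close>

lemma sat_atom_substructure:
  fixes \<AA> \<BB> :: "('r, 'a) struct"
  assumes "is_structure \<tau> \<AA>" and "substructure \<tau> \<BB> \<AA>" and "atom_over \<tau> \<alpha>"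
    and "ran r \<subseteq> univ \<BB>" and None: "(the None :: 'a) \<in> univ \<AA> \<Longrightarrow> (the None :: 'a) \<in> univ \<BB>"
  shows "sat_atom \<BB> r \<alpha> \<longleftrightarrow> sat_atom \<AA> r \<alpha>"
proof (cases \<alpha>)
  case (Rel R xs)
  have "the (r x) \<in> univ \<BB>" if "the (r x) \<in> univ \<AA>" for x
    using that assms(4) None by (cases "r x") (auto simp: ran_def)
  \<comment> \<open>Tuples in \<open>interp \<AA> R\<close> have all entries in
    \<open>univ \<AA>\<close>, so by the previous fact the restriction to \<open>univ \<BB>\<close>
    loses none of those considered here.\<close>
  moreover have "interp \<AA> R \<subseteq> lists (univ \<AA>)"
    using assms(1,3) Rel by (auto simp: is_structure_def)
  ultimately have "map (\<lambda>x. the (r x)) xs \<in> lists (univ \<BB>)"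
    if "map (\<lambda>x. the (r x)) xs \<in> interp \<AA> R"
    using that by fastforce
  moreover have "interp \<BB> R = interp \<AA> R \<inter> lists (univ \<BB>)"
    using assms(2,3) Rel by (auto simp: substructure_def dom_def)
  ultimately show ?thesis using Rel by auto
qed auto

lemma substructure_restrict:
  assumes "is_structure \<tau> \<AA>" and "B \<noteq> {}" and "B \<subseteq> univ \<AA>"
  shows "substructure \<tau> \<lparr>univ = B, interp = (\<lambda>R. interp \<AA> R \<inter> lists B)\<rparr> \<AA>"
  using assms by (fastforce simp: substructure_def is_structure_def)

text \<open>The two games differ only at quantifiers and atoms. At quantifiers Abelard merely loses
  options and \<open>witness\<close> serves Eloise; atoms are absolute. Every move in
  \<open>\<BB>\<close> preserves finite assignments into \<open>univ \<BB>\<close>.\<close>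

lemma safe_set_substructure:
  fixes \<AA> \<BB> :: "('r, 'a) struct"
  assumes A: "is_structure \<tau> \<AA>" and \<phi>: "fm_over \<tau> \<phi>" and B: "substructure \<tau> \<BB> \<AA>"
    and None: "(the None :: 'a) \<in> univ \<AA> \<Longrightarrow> (the None :: 'a) \<in> univ \<BB>"
    and safe: "safe_set (omega_game \<AA> Map.empty \<phi>) Z"
    and witness: "\<And>n p x s m r. finite (dom r) \<Longrightarrow> ran r \<subseteq> univ \<BB> \<Longrightarrow>
      \<exists>a\<in>univ \<AA>. In n (p, r(x \<mapsto> a), s, m) \<in> Z \<Longrightarrow> \<exists>a\<in>univ \<BB>. In n (p, r(x \<mapsto> a), s, m) \<in> Z"
  shows "safe_set (omega_game \<BB> Map.empty \<phi>)
    {u \<in> Z. \<forall>n p r s m. u = In n (p, r, s, m) \<longrightarrow> finite (dom r) \<and> ran r \<subseteq> univ \<BB>}"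
    (is "safe_set ?G ?Z")
proof -
  define Z' where "Z' = ?Z"
  have "safe_set ?G Z'"
    unfolding safe_set_def
  proof
    fix u assume u: "u \<in> Z'"
    have ne: "univ \<BB> \<noteq> {}" "univ \<AA> \<noteq> {}" and sub: "univ \<BB> \<subseteq> univ \<AA>"
      using A B by (auto simp: substructure_def is_structure_def)
    have safe_u: "(moves (omega_game \<AA> Map.empty \<phi>) u = {} \<longrightarrow>
          winner (omega_game \<AA> Map.empty \<phi>) u = Some Eloise) \<and>
        (moves (omega_game \<AA> Map.empty \<phi>) u \<noteq> {} \<longrightarrow>
          turn (omega_game \<AA> Map.empty \<phi>) u = Some Eloise \<longrightarrow>
          moves (omega_game \<AA> Map.empty \<phi>) u \<inter> Z \<noteq> {}) \<and>
        (turn (omega_game \<AA> Map.empty \<phi>) u \<noteq> Some Eloise \<longrightarrow>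
          moves (omega_game \<AA> Map.empty \<phi>) u \<subseteq> Z)"
      using safe u unfolding safe_set_def Z'_def by blast
    show "(moves ?G u = {} \<longrightarrow> winner ?G u = Some Eloise) \<and>
       (moves ?G u \<noteq> {} \<longrightarrow> turn ?G u = Some Eloise \<longrightarrow> moves ?G u \<inter> Z' \<noteq> {}) \<and>
       (turn ?G u \<noteq> Some Eloise \<longrightarrow> moves ?G u \<subseteq> Z')"
    proof (cases u)
      case Init
      then show ?thesis using safe_u by (auto simp: omega_game_def Z'_def)
    next
      case (Raise n)
      then show ?thesis using safe_u by (auto simp: omega_game_def bnd_game_def Z'_def)
    next
      case (In n y)
      obtain p r s m where y: "y = (p, r, s, m)" by (cases y)
      have r: "finite (dom r)" "ran r \<subseteq> univ \<BB>" using u In y by (auto simp: Z'_def)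
      have ran_upd: "ran (r(x \<mapsto> a)) \<subseteq> univ \<BB>" if "a \<in> univ \<BB>" for x a
        using r(2) that by (auto simp: ran_def)
      note sims = In y omega_game_def bnd_game_def
      show ?thesis
      proof (cases "fm_at \<phi> p")
        \<comment> \<open>Vacuous: at an invalid address there is no move and no winner, so such a
          position cannot lie in \<open>Z\<close>.\<close>
        case None
        then show ?thesis using safe_u by (simp add: sims)
      next
        case (Some \<psi>)
        \<comment> \<open>Both quantifiers are treated at once, since quantifier and sign matter
          only through whose turn it is.\<close>
        have quantifier: ?thesis if \<psi>: "\<psi> = Ex x \<chi> \<or> \<psi> = All x \<chi>" for x \<chi>
        proof -
          let ?next = "\<lambda>a. In n (p @ [0], r(x \<mapsto> a), s, m)"
          have moves: "moves (omega_game \<CC> Map.empty \<phi>) u = ?next ` univ \<CC>"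
            for \<CC> :: "('r, 'a) struct"
            using \<psi> Some by (auto simp: sims Setcompr_eq_image image_image)
          have turn: "turn ?G u = turn (omega_game \<AA> Map.empty \<phi>) u"
            by (simp add: sims)
          have Z: "?next a \<in> Z'" if "a \<in> univ \<BB>" "?next a \<in> Z" for a
            using that r(1) ran_upd by (auto simp: Z'_def)
          show ?thesis
          proof (cases "turn ?G u = Some Eloise")
            case True
            then obtain a where "a \<in> univ \<AA>" "?next a \<in> Z"
              using safe_u ne(2) unfolding moves turn by auto
            then obtain b where "b \<in> univ \<BB>" "?next b \<in> Z"
              using witness[OF r] by blast
            then have "?next b \<in> moves ?G u \<inter> Z'" using Z unfolding moves by blast
            then show ?thesis using True by auto
          next
            case False
            then have "?next ` univ \<AA> \<subseteq> Z"
              using safe_u unfolding moves turn by blast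
            then have "moves ?G u \<subseteq> Z'" using Z sub unfolding moves by blast
            moreover have "moves ?G u \<noteq> {}" using ne(1) unfolding moves by blast
            ultimately show ?thesis using False by blast
          qed
        qed
        show ?thesis
        proof (cases \<psi>)
          case (Atom \<alpha>)
          have "sat_atom \<BB> r \<alpha> \<longleftrightarrow> sat_atom \<AA> r \<alpha>"
            using fm_over_fm_at[OF \<phi> Some] Atom
            by (intro sat_atom_substructure[OF A B _ r(2) None]) auto
          then show ?thesis using safe_u Some Atom by (simp add: sims split: if_splits)
        next
          case (Ex x \<chi>)
          then show ?thesis using quantifier by blast
        next
          case (All x \<chi>)
          then show ?thesis using quantifier by blast
        \<comment> \<open>In the remaining cases the moves are the same in both structures and leave
          the assignment unchanged.\<close>
        qed (use safe_u Some r in \<open>auto simp: sims Z'_def\<close>)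
      qed
    qed
  qed
  then show ?thesis unfolding Z'_def .
qed

theorem theorem6p1:
  fixes \<tau> :: "'r vocab" and \<AA> :: "('r, 'a) struct" and \<phi> :: "'r fm"
  assumes "is_structure \<tau> \<AA>"
    and "sentence \<tau> \<phi>"
    and "\<AA> \<Turnstile>\<^sub>\<omega> \<phi>"
  shows "\<exists>\<BB>. substructure \<tau> \<BB> \<AA> \<and> countable (univ \<BB>) \<and> \<BB> \<Turnstile>\<^sub>\<omega> \<phi>"
proof -
  obtain \<sigma> where "winning_strategy (omega_game \<AA> Map.empty \<phi>) \<sigma>"
    using assms(3) by (auto simp: models_omega_def)
  note safe = winning_strategy_safe_set[OF this]
  define Z where "Z = last ` Collect (follows (omega_game \<AA> Map.empty \<phi>) \<sigma>)"
  have "last [Init] \<in> Z"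
    using follows.start[of "omega_game \<AA> Map.empty \<phi>" \<sigma>] unfolding Z_def
    by (intro imageI) (simp add: omega_game_def)
  then have Init: "Init \<in> Z" by simp
  obtain a0 where a0: "a0 \<in> univ \<AA>" using assms(1) by (auto simp: is_structure_def)
  \<comment> \<open>The seed \<open>a0\<close> makes \<open>B\<close> nonempty, and
    \<open>the None\<close> provides for unassigned variables. An index records everything in a
    quantifier move except the assignment and the chosen element.\<close>
  obtain B where B: "countable B" "{a0} \<union> ({the None} \<inter> univ \<AA>) \<subseteq> B" "B \<subseteq> univ \<AA>"
    and witness: "\<And>i (r :: 'a assignment). finite (dom r) \<Longrightarrow> ran r \<subseteq> B \<Longrightarrow>
      \<exists>a\<in>univ \<AA>. (\<lambda>(n, p, x, s, m) r a. In n (p, r(x \<mapsto> a), s, m) \<in> Z) i r a \<Longrightarrow>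
      \<exists>a\<in>B. (\<lambda>(n, p, x, s, m) r a. In n (p, r(x \<mapsto> a), s, m) \<in> Z) i r a"
    using a0 by (rule_tac countable_witness_closure[of "{a0} \<union> ({the None} \<inter> univ \<AA>)" "univ \<AA>"
        "\<lambda>(n, p, x, s, m) r a. In n (p, r(x \<mapsto> a), s, m) \<in> Z"]) auto
  define \<BB> where "\<BB> = \<lparr>univ = B, interp = (\<lambda>R. interp \<AA> R \<inter> lists B)\<rparr>"
  have sub: "substructure \<tau> \<BB> \<AA>"
    unfolding \<BB>_def using assms(1) B by (intro substructure_restrict) auto
  have "safe_set (omega_game \<BB> Map.empty \<phi>)
    {u \<in> Z. \<forall>n p r s m. u = In n (p, r, s, m) \<longrightarrow> finite (dom r) \<and> ran r \<subseteq> univ \<BB>}"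
  proof (rule safe_set_substructure[OF assms(1) _ sub])
    show "fm_over \<tau> \<phi>" using assms(2) by (simp add: sentence_def)
    show "safe_set (omega_game \<AA> Map.empty \<phi>) Z" using safe by (simp add: Z_def)
    show "the None \<in> univ \<BB>" if "the None \<in> univ \<AA>" using that B(2) by (auto simp: \<BB>_def)
    show "\<exists>a\<in>univ \<BB>. In n (p, r(x \<mapsto> a), s, m) \<in> Z"
      if "finite (dom r)" "ran r \<subseteq> univ \<BB>" "\<exists>a\<in>univ \<AA>. In n (p, r(x \<mapsto> a), s, m) \<in> Z"
      for n p x s m and r :: "'a assignment"
      using witness[of r "(n, p, x, s, m)"] that by (simp add: \<BB>_def)
  qed
  \<comment> \<open>\<open>Init\<close> survives the restriction of \<open>Z\<close> because only
    \<open>In\<close> positions are constrained.\<close>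
  then have "\<BB> \<Turnstile>\<^sub>\<omega> \<phi>"
    unfolding models_omega_def
    by (rule safe_set_winning_strategy[OF wf_omega_game]) (use Init in \<open>simp add: omega_game_def\<close>)
  then show ?thesis using sub B(1) by (auto simp: \<BB>_def)
qed

end
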